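(* Let $V$ be a complex vector space with three bilinear operations $\lhd,\rhd,\circ: V\times V\to V$. Let $R=\mathbb{C}[\partial]V:=\mathbb{C}[\partial]\otimes V$ be the free $\mathbb{C}[\partial]$-module on $V$, equipped with the $\lambda$-product $R\times R\to R[\lambda]$ determined by $$a_\lambda b=\partial(b\lhd a)+a\circ b+\lambda(a\rhd b+b\lhd a),\qquad a,b\in V,$$ and extended to all of $R$ by conformal sesquilinearity ($\partial a_\lambda b=-\lambda a_\lambda b$, $a_\lambda \partial b=(\partial+\lambda)a_\lambda b$). Then $(R,\cdot_\lambda\cdot)$ is a (quadratic) left-symmetric conformal algebra if and only if $(V,\lhd,\rhd,\circ)$ is a pre-Gel'fand-Dorfman algebra.
   Context: All vector spaces are over $\mathbb{C}$; $V[\lambda]$ denotes polynomials in $\lambda$ with coefficients in $V$. A left-symmetric algebra $(A,\circ)$ is a vector space with a bilinear product satisfying $(a\circ b)\circ c-a\circ(b\circ c)=(b\circ a)\circ c-b\circ(a\circ c)$ for all $a,b,c\in A$. A left-symmetric conformal algebra is a $\mathbb{C}[\partial]$-module $R$ with a $\mathbb{C}$-bilinear map $R\times R\to R[\lambda]$, $(a,b)\mapsto a_\lambda b$, such that for all $a,b,c\in R$: $\partial a_\lambda b=-\lambda a_\lambda b$, $a_\lambda\partial b=(\partial+\lambda)a_\lambda b$, and $(a_\lambda b)_{\lambda+\mu}c-a_\lambda(b_\mu c)=(b_\mu a)_{\lambda+\mu}c-b_\mu(a_\lambda c)$. It is called quadratic if $R=\mathbb{C}[\partial]V$ is free over a vector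 space $V$ and for all $u,v\in V$, $u_\lambda v=\partial w_1+w_2+\lambda w_3$ with $w_1,w_2,w_3\in V$. A pre-Novikov algebra $(A,\lhd,\rhd)$ is a vector space with two bilinear operations such that for all $a,b,c\in A$: $a\rhd(b\rhd c)=(a\rhd b+a\lhd b)\rhd c+b\rhd(a\rhd c)-(b\rhd a+b\lhd a)\rhd c$; $a\rhd(b\lhd c)=(a\rhd b)\lhd c+b\lhd(a\lhd c+a\rhd c)-(b\lhd a)\lhd c$; $(a\lhd b+a\rhd b)\rhd c=(a\rhd c)\lhd b$; $(a\lhd b)\lhd c=(a\lhd c)\lhd b$. A pre-Gel'fand-Dorfman algebra $(A,\lhd,\rhd,\circ)$ is a vector space such that $(A,\lhd,\rhd)$ is a pre-Novikov algebra, $(A,\circ)$ is a left-symmetric algebra, and for all $a,b,c\in A$: $c\lhd(a\circ b-b\circ a)-a\circ(c\lhd b)-(b\circ c)\lhd a=-b\circ(c\lhd a)-(a\circ c)\lhd b$; $(a\circ b-b\circ a)\rhd c+(a\lhd b+a\rhd b)\circ c=a\rhd(b\circ c)-b\circ(a\rhd c)+(a\circ c)\lhd b$. *)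

theory Defs
  imports Complex_Main "HOL-Computational_Algebra.Polynomial"
begin

section \<open>Algebras with bilinear operations over the complex numbers\<close>

definition bilinear_map ::
  "(complex \<Rightarrow> 'a::ab_group_add \<Rightarrow> 'a) \<Rightarrow> (complex \<Rightarrow> 'b::ab_group_add \<Rightarrow> 'b) \<Rightarrow>
   (complex \<Rightarrow> 'c::ab_group_add \<Rightarrow> 'c) \<Rightarrow> ('a \<Rightarrow> 'b \<Rightarrow> 'c) \<Rightarrow> bool" where
  "bilinear_map s1 s2 s3 f \<longleftrightarrow>
     (\<forall>x. Vector_Spaces.linear s2 s3 (\<lambda>y. f x y)) \<and>
     (\<forall>y. Vector_Spaces.linear s1 s3 (\<lambda>x. f x y))"

locale left_symmetric_algebra = vector_space scale
  for scale :: "complex \<Rightarrow> 'v::ab_group_add \<Rightarrow> 'v" +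
  fixes circ :: "'v \<Rightarrow> 'v \<Rightarrow> 'v" (infixl "\<odot>" 70)
  assumes circ_bilinear: "bilinear_map scale scale scale circ"
    and left_symmetric:
      "(a \<odot> b) \<odot> c - a \<odot> (b \<odot> c) = (b \<odot> a) \<odot> c - b \<odot> (a \<odot> c)"

locale pre_novikov_algebra = vector_space scale
  for scale :: "complex \<Rightarrow> 'v::ab_group_add \<Rightarrow> 'v" +
  fixes lhd :: "'v \<Rightarrow> 'v \<Rightarrow> 'v" (infixl "\<lhd>" 70)
    and rhd :: "'v \<Rightarrow> 'v \<Rightarrow> 'v" (infixl "\<rhd>" 70)
  assumes lhd_bilinear: "bilinear_map scale scale scale lhd"
    and rhd_bilinear: "bilinear_map scale scale scale rhd"
    and pre_novikov1:
      "a \<rhd> (b \<rhd> c) = (a \<rhd> b + a \<lhd> b) \<rhd> c + b \<rhd> (a \<rhd> c) - (b \<rhd> a + b \<lhd> a) \<rhd> c"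
    and pre_novikov2:
      "a \<rhd> (b \<lhd> c) = (a \<rhd> b) \<lhd> c + b \<lhd> (a \<lhd> c + a \<rhd> c) - (b \<lhd> a) \<lhd> c"
    and pre_novikov3: "(a \<lhd> b + a \<rhd> b) \<rhd> c = (a \<rhd> c) \<lhd> b"
    and pre_novikov4: "(a \<lhd> b) \<lhd> c = (a \<lhd> c) \<lhd> b"

locale pre_gelfand_dorfman_algebra =
  pre_novikov_algebra scale lhd rhd + left_symmetric_algebra scale circ
  for scale :: "complex \<Rightarrow> 'v::ab_group_add \<Rightarrow> 'v"
    and lhd :: "'v \<Rightarrow> 'v \<Rightarrow> 'v" (infixl "\<lhd>" 70)
    and rhd :: "'v \<Rightarrow> 'v \<Rightarrow> 'v" (infixl "\<rhd>" 70)
    and circ :: "'v \<Rightarrow> 'v \<Rightarrow> 'v" (infixl "\<odot>" 70) +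
  assumes pre_gd1:
      "c \<lhd> (a \<odot> b - b \<odot> a) - a \<odot> (c \<lhd> b) - (b \<odot> c) \<lhd> a
       = - (b \<odot> (c \<lhd> a)) - (a \<odot> c) \<lhd> b"
    and pre_gd2:
      "(a \<odot> b - b \<odot> a) \<rhd> c + (a \<lhd> b + a \<rhd> b) \<odot> c
       = a \<rhd> (b \<odot> c) - b \<odot> (a \<rhd> c) + (a \<odot> c) \<lhd> b"


section \<open>Left-symmetric conformal algebras\<close>

text \<open>For a polynomial \<open>p = \<Sum>\<^sub>i x\<^sup>i p\<^sub>i\<close>, the value obtained by letting \<open>x\<close> act as the operator
  \<open>X\<close> and mapping each coefficient by \<open>f\<close>, i.e. \<open>\<Sum>\<^sub>i X\<^sup>i (f p\<^sub>i)\<close>.\<close>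

definition eval_at :: "('m \<Rightarrow> 'm) \<Rightarrow> ('a \<Rightarrow> 'm) \<Rightarrow> 'a::zero poly \<Rightarrow> 'm::ab_group_add" where
  "eval_at X f p = (\<Sum>i\<le>degree p. (X ^^ i) (f (coeff p i)))"

text \<open>\<open>R[\<lambda>]\<close> is \<open>'r poly\<close>, and \<open>pCons 0\<close> is multiplication by the indeterminate.
  \<open>R[\<lambda>, \<mu>]\<close> is \<open>'r poly poly\<close>, the outer indeterminate being \<open>\<mu>\<close> and the inner one \<open>\<lambda>\<close>;
  the next three operators are multiplication by \<open>\<lambda>\<close>, by \<open>\<mu>\<close> and by \<open>\<lambda> + \<mu>\<close> on it.\<close>

definition mult_lam :: "'r::ab_group_add poly poly \<Rightarrow> 'r poly poly" where
  "mult_lam P = map_poly (pCons 0) P"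

definition mult_mu :: "'r::ab_group_add poly poly \<Rightarrow> 'r poly poly" where
  "mult_mu P = pCons 0 P"

definition mult_lam_mu :: "'r::ab_group_add poly poly \<Rightarrow> 'r poly poly" where
  "mult_lam_mu P = mult_lam P + mult_mu P"

text \<open>\<open>product_at pr X a b\<close> is \<open>a\<^sub>X b \<in> R[\<lambda>, \<mu>]\<close>, the \<open>\<lambda>\<close>-product of \<open>a\<close> and \<open>b\<close> with the
  indeterminate replaced by \<open>X\<close>, one of \<open>\<lambda>\<close>, \<open>\<mu>\<close>, \<open>\<lambda> + \<mu>\<close>.\<close>

definition product_at ::
  "('r \<Rightarrow> 'r \<Rightarrow> 'r poly) \<Rightarrow> ('r poly poly \<Rightarrow> 'r poly poly) \<Rightarrow> 'r \<Rightarrow> 'r \<Rightarrow> 'r::ab_group_add poly poly"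
  where "product_at pr X a b = eval_at X (\<lambda>r. [:[:r:]:]) (pr a b)"

text \<open>The \<open>\<complex>[\<partial>]\<close>-module structure is the action \<open>smul\<close> of \<open>complex poly\<close>; the operator \<open>\<partial>\<close>
  is \<open>smul [:0, 1:]\<close> and complex scalars act through constant polynomials.  In the last axiom
  an outer product is extended coefficientwise to the polynomial inside it, e.g.
  \<open>(a\<^sub>\<lambda> b)\<^bsub>\<lambda>+\<mu>\<^esub> c = \<Sum>\<^sub>i \<lambda>\<^sup>i ((r\<^sub>i)\<^bsub>\<lambda>+\<mu>\<^esub> c)\<close> for \<open>a\<^sub>\<lambda> b = \<Sum>\<^sub>i \<lambda>\<^sup>i r\<^sub>i\<close>.\<close>

locale left_symmetric_conformal_algebra = module smul
  for smul :: "complex poly \<Rightarrow> 'r::ab_group_add \<Rightarrow> 'r" +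
  fixes pr :: "'r \<Rightarrow> 'r \<Rightarrow> 'r poly"
  assumes pr_bilinear:
      "bilinear_map (\<lambda>k. smul [:k:]) (\<lambda>k. smul [:k:]) (\<lambda>k. map_poly (smul [:k:])) pr"
    and sesquilinear_left: "pr (smul [:0, 1:] a) b = - pCons 0 (pr a b)"
    and sesquilinear_right:
      "pr a (smul [:0, 1:] b) = map_poly (smul [:0, 1:]) (pr a b) + pCons 0 (pr a b)"
    and conformal_left_symmetric:
      "eval_at mult_lam (\<lambda>r. product_at pr mult_lam_mu r c) (pr a b)
         - eval_at mult_mu (\<lambda>r. product_at pr mult_lam a r) (pr b c)
       = eval_at mult_mu (\<lambda>r. product_at pr mult_lam_mu r c) (pr b a)
         - eval_at mult_lam (\<lambda>r. product_at pr mult_mu b r) (pr a c)"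


section \<open>The free module \<open>\<complex>[\<partial>]V\<close>\<close>

text \<open>\<open>\<complex>[\<partial>]V\<close> is \<open>'v poly\<close>, polynomials in \<open>\<partial>\<close> with coefficients in \<open>V\<close>, with \<open>v \<in> V\<close>
  embedded as \<open>[:v:]\<close>.  In \<open>(\<complex>[\<partial>]V)[\<lambda>]\<close>, which is \<open>'v poly poly\<close>, the outer indeterminate
  is \<open>\<lambda>\<close> and the inner one \<open>\<partial>\<close>; so \<open>[:[:w\<^sub>2, w\<^sub>1:], [:w\<^sub>3:]:]\<close> is \<open>\<partial>w\<^sub>1 + w\<^sub>2 + \<lambda>w\<^sub>3\<close>.\<close>

definition free_smul ::
  "(complex \<Rightarrow> 'v \<Rightarrow> 'v) \<Rightarrow> complex poly \<Rightarrow> 'v poly \<Rightarrow> 'v::ab_group_add poly" where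
  "free_smul scale p r = eval_at (pCons 0) (\<lambda>k. map_poly (scale k) r) p"

locale quadratic_left_symmetric_conformal_algebra =
  vector_space scale + R: left_symmetric_conformal_algebra "free_smul scale" pr
  for scale :: "complex \<Rightarrow> 'v::ab_group_add \<Rightarrow> 'v"
    and pr :: "'v poly \<Rightarrow> 'v poly \<Rightarrow> 'v poly poly" +
  assumes quadratic: "\<exists>w1 w2 w3. pr [:u:] [:v:] = [:[:w2, w1:], [:w3:]:]"

text \<open>The extension of \<open>g : V \<times> V \<rightarrow> (\<complex>[\<partial>]V)[\<lambda>]\<close> to \<open>\<complex>[\<partial>]V\<close> by conformal sesquilinearity:
  \<open>(\<Sum>\<^sub>i \<partial>\<^sup>i u\<^sub>i)\<^sub>\<lambda> (\<Sum>\<^sub>j \<partial>\<^sup>j v\<^sub>j) = \<Sum>\<^sub>i \<Sum>\<^sub>j (-\<lambda>)\<^sup>i (\<partial>+\<lambda>)\<^sup>j g u\<^sub>i v\<^sub>j\<close>.\<close>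

definition conformal_extension ::
  "('v \<Rightarrow> 'v \<Rightarrow> 'v poly poly) \<Rightarrow> 'v poly \<Rightarrow> 'v poly \<Rightarrow> 'v::ab_group_add poly poly" where
  "conformal_extension g a b =
     eval_at (\<lambda>P. - pCons 0 P)
       (\<lambda>u. eval_at (\<lambda>P. map_poly (pCons 0) P + pCons 0 P) (\<lambda>v. g u v) b) a"

definition gd_product ::
  "('v \<Rightarrow> 'v \<Rightarrow> 'v) \<Rightarrow> ('v \<Rightarrow> 'v \<Rightarrow> 'v) \<Rightarrow> ('v \<Rightarrow> 'v \<Rightarrow> 'v) \<Rightarrow>
   'v poly \<Rightarrow> 'v poly \<Rightarrow> 'v::ab_group_add poly poly" where
  "gd_product lhd rhd circ =
     conformal_extension (\<lambda>a b. [:[:circ a b, lhd b a:], [:rhd a b + lhd b a:]:])"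


section \<open>\<open>conformal_extension\<close> is the unique sesquilinear extension\<close>

definition additive_op :: "('a::ab_group_add \<Rightarrow> 'm::ab_group_add) \<Rightarrow> bool" where
  "additive_op X \<longleftrightarrow> (\<forall>x y. X (x + y) = X x + X y)"

lemma additive_opD: "additive_op X \<Longrightarrow> X (x + y) = X x + X y"
  by (simp add: additive_op_def)

lemma additive_op_zero: "additive_op X \<Longrightarrow> X 0 = 0"
  using additive_opD[of X 0 0] by simp

lemma additive_op_sum: "additive_op X \<Longrightarrow> X (\<Sum>i\<in>A. h i) = (\<Sum>i\<in>A. X (h i))"
  by (induction A rule: infinite_finite_induct) (simp_all add: additive_opD additive_op_zero)

lemma additive_op_funpow:
  fixes X :: "'m::ab_group_add \<Rightarrow> 'm"
  shows "additive_op X \<Longrightarrow> additive_op (X ^^ i)"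
  by (induction i) (simp_all add: additive_op_def)

lemma eval_at_bound:
  assumes X: "additive_op X" and f: "f 0 = 0" and n: "degree p \<le> n"
  shows "eval_at X f p = (\<Sum>i\<le>n. (X ^^ i) (f (coeff p i)))"
  unfolding eval_at_def
proof (rule sum.mono_neutral_left)
  show "\<forall>i\<in>{..n} - {..degree p}. (X ^^ i) (f (coeff p i)) = 0"
    using additive_op_zero[OF additive_op_funpow[OF X]] by (auto simp: coeff_eq_0 f)
qed (use n in auto)

lemma eval_at_add:
  assumes X: "additive_op X" and f: "additive_op f"
  shows "eval_at X f (p + q) = eval_at X f p + eval_at X f q"
proof -
  define n where "n = max (degree p) (degree q)"
  have n: "degree (p + q) \<le> n" "degree p \<le> n" "degree q \<le> n"
    using degree_add_le_max[of p q] by (auto simp: n_def)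
  have "eval_at X f r = (\<Sum>i\<le>n. (X ^^ i) (f (coeff r i)))" if "degree r \<le> n" for r
    using that by (intro eval_at_bound X additive_op_zero[OF f])
  with n show ?thesis
    by (simp add: additive_opD[OF f] additive_opD[OF additive_op_funpow[OF X]] sum.distrib)
qed

lemma eval_at_add_fun:
  assumes X: "additive_op X"
  shows "eval_at X (\<lambda>x. f x + g x) p = eval_at X f p + eval_at X g p"
  by (simp add: eval_at_def additive_opD[OF additive_op_funpow[OF X]] sum.distrib)

lemma eval_at_pCons:
  assumes X: "additive_op X" and f0: "f 0 = 0"
  shows "eval_at X f (pCons a p) = f a + X (eval_at X f p)"
proof -
  have "eval_at X f (pCons a p) = (\<Sum>i\<le>Suc (degree p). (X ^^ i) (f (coeff (pCons a p) i)))"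
    by (rule eval_at_bound[where n = "Suc (degree p)"]) (simp_all add: X f0 degree_pCons_le)
  also have "\<dots> = f a + X (eval_at X f p)"
    unfolding eval_at_def additive_op_sum[OF X] by (subst sum.atMost_Suc_shift) simp
  finally show ?thesis .
qed

lemma free_smul_partial:
  assumes "vector_space scale"
  shows "free_smul scale [:0, 1:] r = pCons 0 r"
proof -
  interpret vector_space scale by fact
  have "map_poly (scale 0) r = 0" "map_poly (scale 1) r = r"
    by (simp_all add: poly_eq_iff coeff_map_poly)
  then show ?thesis by (simp add: free_smul_def eval_at_def)
qed

lemma additive_op_left: "additive_op (\<lambda>P :: 'v::ab_group_add poly poly. - pCons 0 P)"
  by (simp add: additive_op_def)

lemma additive_op_right:
  "additive_op (\<lambda>P :: 'v::ab_group_add poly poly. map_poly (pCons 0) P + pCons 0 P)"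
  by (simp add: additive_op_def poly_eq_iff coeff_map_poly coeff_pCons split: nat.splits)

context
  fixes g :: "'v::ab_group_add \<Rightarrow> 'v \<Rightarrow> 'v poly poly"
  assumes g_add_left: "\<And>u u' v. g (u + u') v = g u v + g u' v"
    and g_add_right: "\<And>u v v'. g u (v + v') = g u v + g u v'"
begin

lemma conformal_extension_zero:
  "g 0 = (\<lambda>_. 0)" "g u 0 = 0"
  "eval_at (\<lambda>P. map_poly (pCons 0) P + pCons 0 P) (\<lambda>v. 0) (b :: 'v poly) = (0 :: 'v poly poly)"
  using g_add_left[of 0 0] g_add_right[of _ 0 0]
  by (simp_all add: fun_eq_iff eval_at_def
      additive_op_zero[OF additive_op_funpow[OF additive_op_right]])

lemma conformal_extension_gen: "conformal_extension g [:u:] [:v:] = g u v"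
  by (simp add: conformal_extension_def eval_at_def)

lemma conformal_extension_add_left:
  "conformal_extension g (a + a') b = conformal_extension g a b + conformal_extension g a' b"
proof -
  have "g (u + u') = (\<lambda>v. g u v + g u' v)" for u u'
    by (simp add: fun_eq_iff g_add_left)
  then have "additive_op (\<lambda>u. eval_at (\<lambda>P. map_poly (pCons 0) P + pCons 0 P) (g u) b)"
    by (simp add: additive_op_def eval_at_add_fun[OF additive_op_right])
  then show ?thesis
    unfolding conformal_extension_def by (rule eval_at_add[OF additive_op_left])
qed

lemma conformal_extension_add_right:
  "conformal_extension g a (b + b') = conformal_extension g a b + conformal_extension g a b'"
proof -
  have "additive_op (g u)" for u by (simp add: additive_op_def g_add_right)
  then show ?thesis
    unfolding conformal_extension_def
    by (simp only: eval_at_add[OF additive_op_right] eval_at_add_fun[OF additive_op_left])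
qed

lemma conformal_extension_pCons_left:
  "conformal_extension g (pCons u a) b =
     eval_at (\<lambda>P. map_poly (pCons 0) P + pCons 0 P) (\<lambda>v. g u v) b
     - pCons 0 (conformal_extension g a b)"
  unfolding conformal_extension_def
  by (subst eval_at_pCons[OF additive_op_left]) (simp_all add: conformal_extension_zero)

lemma conformal_extension_partial_left:
  "conformal_extension g (pCons 0 a) b = - pCons 0 (conformal_extension g a b)"
  by (simp only: conformal_extension_pCons_left conformal_extension_zero diff_0)

lemma conformal_extension_partial_right:
  "conformal_extension g a (pCons 0 b) =
     map_poly (pCons 0) (conformal_extension g a b) + pCons 0 (conformal_extension g a b)"
proof (induction a)
  case 0
  show ?case
    by (simp add: conformal_extension_def eval_at_def conformal_extension_zero
        additive_op_zero[OF additive_op_funpow[OF additive_op_right]])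
next
  case (pCons u a)
  have *: "map_poly (pCons 0) (P - pCons 0 Q)
      = map_poly (pCons 0) P - pCons 0 (map_poly (pCons 0) Q)" for P Q :: "'v poly poly"
    by (simp add: poly_eq_iff coeff_map_poly coeff_pCons split: nat.splits)
  show ?case
    by (simp add: conformal_extension_pCons_left * pCons.IH
        eval_at_pCons[OF additive_op_right] conformal_extension_zero)
qed

lemma conformal_extension_unique:
  assumes "\<And>a a' b. F (a + a') b = F a b + F a' b" "\<And>a b b'. F a (b + b') = F a b + F a b'"
    and "\<And>a b. F (pCons 0 a) b = - pCons 0 (F a b)"
    and "\<And>a b. F a (pCons 0 b) = map_poly (pCons 0) (F a b) + pCons 0 (F a b)"
    and "\<And>u v. F [:u:] [:v:] = g u v"
  shows "F a b = conformal_extension g a b"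
proof -
  have split: "pCons x p = [:x:] + pCons 0 p" for x :: 'v and p by simp
  have F0: "F 0 b = 0" "F a 0 = 0" for a b
    using assms(1)[of 0 0] assms(2)[of _ 0 0] by simp_all
  have C0: "conformal_extension g 0 b = 0" "conformal_extension g a 0 = 0" for a b
    using conformal_extension_add_left[of 0 0] conformal_extension_add_right[of _ 0 0] by simp_all
  have 1: "F [:u:] b = conformal_extension g [:u:] b" for u
  proof (induction b)
    case (pCons v b)
    then show ?case
      by (subst (1 2) split) (simp only: assms conformal_extension_add_right
          conformal_extension_partial_right conformal_extension_gen)
  qed (simp only: F0 C0)
  show ?thesis
  proof (induction a)
    case (pCons u a)
    then show ?case
      by (subst (1 2) split) (simp only: assms conformal_extension_add_left
          conformal_extension_partial_left 1)
  qed (simp only: F0 C0)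
qed

end

end

theory Submission
  imports Defs
begin

text \<open>Both sides of the conformal left-symmetry identity are sesquilinear in \<open>a\<close>, \<open>b\<close>, \<open>c\<close>:
  replacing \<open>a\<close> by \<open>\<partial>a\<close> multiplies them by \<open>-\<lambda>\<close>, replacing \<open>b\<close> by \<open>\<partial>b\<close> multiplies them by
  \<open>-\<mu>\<close>, and replacing \<open>c\<close> by \<open>\<partial>c\<close> applies \<open>\<partial> + \<lambda> + \<mu>\<close>.  Hence the identity holds on all of
  \<open>\<complex>[\<partial>]V\<close> as soon as it holds on \<open>V\<close> (\<open>left_symmetric_extend\<close>).  The other axioms of a
  left-symmetric conformal algebra only ask that \<open>\<complex>[\<partial>]V\<close> be a module and that the product be
  bilinear and sesquilinear, and they follow from the bilinearity of the three operations.

  For \<open>a\<close>, \<open>b\<close>, \<open>c\<close> in \<open>V\<close> the conformal associator is a polynomial of degree at most two in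
  \<open>\<partial>\<close>, \<open>\<lambda>\<close>, \<open>\<mu>\<close> (\<open>associator_lam_mu\<close>), and the identity says that it is invariant under
  exchanging \<open>a\<close> with \<open>b\<close> and \<open>\<lambda>\<close> with \<open>\<mu>\<close> together.  Comparing coefficients gives seven
  conditions on \<open>V\<close>, some of them a second time with \<open>a\<close> and \<open>b\<close> exchanged.  These conditions
  are not literally the pre-Gel'fand-Dorfman axioms, but a unitriangular combination of them, up
  to sign (\<open>coeff_differences\<close>): \<open>1\<close>, \<open>\<partial>\<close> and \<open>\<partial>\<^sup>2\<close> give the left-symmetry of the
  product \<open>\<circ>\<close>, the first compatibility condition and the fourth pre-Novikov axiom; knowing
  these, \<open>\<lambda>\<close> and \<open>\<lambda>\<partial>\<close> give the second compatibility condition and the second pre-Novikov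
  axiom; and then \<open>\<lambda>\<^sup>2\<close> and \<open>\<lambda>\<mu>\<close> give the third and the first.\<close>

section \<open>Evaluation of polynomials at operators\<close>

lemma additive_op_minus: "additive_op X \<Longrightarrow> X (- x) = - X x"
  using additive_opD[of X x "- x"] additive_op_zero[of X]
  by (simp add: eq_neg_iff_add_eq_0 add.commute)

lemma additive_op_diff: "additive_op X \<Longrightarrow> X (x - y) = X x - X y"
  using additive_opD[of X x "- y"] by (simp add: additive_op_minus)

lemma additive_op_map_poly: "additive_op f \<Longrightarrow> additive_op (map_poly f)"
  by (simp add: additive_op_def poly_eq_iff coeff_map_poly additive_op_zero[unfolded additive_op_def])

lemma additive_op_pCons_zero: "additive_op (pCons 0)"
  by (simp add: additive_op_def)

lemma additive_op_plus: "additive_op X \<Longrightarrow> additive_op Y \<Longrightarrow> additive_op (\<lambda>P. X P + Y P)"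
  by (simp add: additive_op_def algebra_simps)

lemma eval_at_zero: "f 0 = 0 \<Longrightarrow> eval_at X f 0 = 0"
  by (simp add: eval_at_def)

lemma eval_at_const: "eval_at X f [:x:] = f x"
  by (simp add: eval_at_def)

lemma eval_at_pCons_zero:
  "additive_op X \<Longrightarrow> f 0 = 0 \<Longrightarrow> eval_at X f (pCons 0 p) = X (eval_at X f p)"
  by (simp add: eval_at_pCons)

lemma eval_at_uminus:
  "additive_op X \<Longrightarrow> additive_op f \<Longrightarrow> eval_at X f (- p) = - eval_at X f p"
  using additive_op_minus[of "eval_at X f"] by (simp add: additive_op_def eval_at_add)

text \<open>Evaluation at \<open>X\<close> is linear over every operator that commutes with \<open>X\<close>.  This is what moves
  \<open>\<partial>\<close>, \<open>\<lambda>\<close>, \<open>\<mu>\<close> and the scalars out of a product that is applied coefficientwise.\<close>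

lemma eval_at_commute:
  assumes "additive_op S" and "\<And>y. S (X y) = X (S y)"
  shows "eval_at X (\<lambda>x. S (f x)) p = S (eval_at X f p)"
proof -
  have "S ((X ^^ i) y) = (X ^^ i) (S y)" for i y
    by (induction i) (simp_all add: assms)
  then show ?thesis
    by (simp add: eval_at_def additive_op_sum[OF assms(1)])
qed

lemma eval_at_map_poly:
  assumes "additive_op X" "f 0 = 0" "s 0 = 0"
  shows "eval_at X f (map_poly s p) = eval_at X (\<lambda>x. f (s x)) p"
  by (induction p) (simp_all add: eval_at_zero eval_at_pCons map_poly_pCons assms)


section \<open>Sesquilinear products\<close>

text \<open>The operator \<open>\<partial>\<close> on \<open>(\<complex>[\<partial>]V)[\<lambda>, \<mu>]\<close>: there \<open>\<partial>\<close> is the innermost of three nested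
  indeterminates.\<close>

abbreviation partial2 :: "'v::ab_group_add poly poly poly \<Rightarrow> 'v poly poly poly" where
  "partial2 \<equiv> map_poly (map_poly (pCons 0))"

lemma additive_op_partial2: "additive_op partial2"
  by (intro additive_op_map_poly additive_op_pCons_zero)

text \<open>The operators that may be substituted for the indeterminate of the product; the instances that
  matter are multiplication by \<open>\<lambda>\<close>, by \<open>\<mu>\<close> and by \<open>\<lambda> + \<mu>\<close>.  Commuting with \<open>\<partial>\<close> is what lets
  sesquilinearity on the right survive the substitution.\<close>

definition spectral_op :: "('v::ab_group_add poly poly poly \<Rightarrow> 'v poly poly poly) \<Rightarrow> bool" where
  "spectral_op X \<longleftrightarrow> additive_op X \<and> (\<forall>P. partial2 (X P) = X (partial2 P))"

lemma spectral_op_plus: "spectral_op X \<Longrightarrow> spectral_op Y \<Longrightarrow> spectral_op (\<lambda>P. X P + Y P)"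
  by (simp add: spectral_op_def additive_op_plus additive_opD[OF additive_op_partial2])

lemma spectral_op_mult_lam: "spectral_op mult_lam"
  and spectral_op_mult_mu: "spectral_op mult_mu"
  and mult_lam_mult_mu: "mult_lam (mult_mu P) = mult_mu (mult_lam P)"
  unfolding spectral_op_def additive_op_def
  by (simp_all add: mult_lam_def[abs_def] mult_mu_def[abs_def] poly_eq_iff coeff_map_poly
      coeff_pCons split: nat.splits)

text \<open>\<open>(a\<^sub>X b)\<^bsub>X+Z\<^esub> c - a\<^sub>X (b\<^sub>Z c)\<close>.  Keeping \<open>X\<close> and \<open>Z\<close> as parameters lets the two sides of the
  conformal left-symmetry identity be the same expression, at \<open>(\<lambda>, \<mu>)\<close> and at \<open>(\<mu>, \<lambda>)\<close>.\<close>

definition conformal_associator ::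
  "('v poly \<Rightarrow> 'v poly \<Rightarrow> 'v poly poly) \<Rightarrow>
   ('v poly poly poly \<Rightarrow> 'v poly poly poly) \<Rightarrow> ('v poly poly poly \<Rightarrow> 'v poly poly poly) \<Rightarrow>
   'v poly \<Rightarrow> 'v poly \<Rightarrow> 'v poly \<Rightarrow> 'v::ab_group_add poly poly poly"
  where "conformal_associator pr X Z a b c =
     eval_at X (\<lambda>r. product_at pr (\<lambda>P. X P + Z P) r c) (pr a b)
       - eval_at Z (\<lambda>r. product_at pr X a r) (pr b c)"

text \<open>Multiplication by \<open>\<partial>\<close> on \<open>\<complex>[\<partial>]V\<close> is \<open>pCons 0\<close>, so the additive group \<open>V\<close> already determines
  what sesquilinearity means.\<close>

locale sesquilinear_product =
  fixes pr :: "'v::ab_group_add poly \<Rightarrow> 'v poly \<Rightarrow> 'v poly poly"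
  assumes add_left: "pr (a + a') b = pr a b + pr a' b"
    and add_right: "pr a (b + b') = pr a b + pr a b'"
    and partial_left: "pr (pCons 0 a) b = - pCons 0 (pr a b)"
    and partial_right: "pr a (pCons 0 b) = map_poly (pCons 0) (pr a b) + pCons 0 (pr a b)"
begin

context
  fixes X :: "'v poly poly poly \<Rightarrow> 'v poly poly poly"
  assumes X: "spectral_op X"
begin

lemma product_at_add_left: "product_at pr X (a + a') b = product_at pr X a b + product_at pr X a' b"
  and product_at_add_right: "product_at pr X a (b + b') = product_at pr X a b + product_at pr X a b'"
  using X by (simp_all add: product_at_def add_left add_right eval_at_add additive_op_def
      spectral_op_def)

lemma additive_op_product_at: "additive_op (\<lambda>r. product_at pr X r c)"
  "additive_op (\<lambda>r. product_at pr X a r)"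
  by (simp_all add: additive_op_def product_at_add_left product_at_add_right)

lemma product_at_partial_left: "product_at pr X (pCons 0 a) b = - X (product_at pr X a b)"
proof -
  have X': "additive_op X" using X by (simp add: spectral_op_def)
  have "additive_op (\<lambda>r :: 'v poly. [:[:r:]:])" by (simp add: additive_op_def)
  from eval_at_uminus[OF X' this] show ?thesis
    by (simp add: product_at_def partial_left eval_at_pCons_zero[OF X'] additive_op_minus[OF X'])
qed

lemma product_at_partial_right:
  "product_at pr X a (pCons 0 b) = partial2 (product_at pr X a b) + X (product_at pr X a b)"
proof -
  have "eval_at X (\<lambda>r. [:[:r:]:]) (map_poly (pCons 0) p) = partial2 (eval_at X (\<lambda>r. [:[:r:]:]) p)"
    for p
    using X by (subst eval_at_commute[symmetric])
      (simp_all add: additive_op_partial2 spectral_op_def eval_at_map_poly map_poly_pCons)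
  then show ?thesis
    using X by (simp add: product_at_def partial_right eval_at_add eval_at_pCons_zero
        additive_op_def spectral_op_def)
qed

end

context
  fixes X Z :: "'v poly poly poly \<Rightarrow> 'v poly poly poly"
  assumes X: "spectral_op X" and Z: "spectral_op Z" and XZ: "\<And>P. X (Z P) = Z (X P)"
begin

private lemma additive:
  "additive_op X" "additive_op Z" "additive_op (\<lambda>P. X P + Z P)" "spectral_op (\<lambda>P. X P + Z P)"
  using X Z
  by (simp_all add: spectral_op_def[of X] spectral_op_def[of Z] spectral_op_plus additive_op_plus)

private lemmas outer = additive_op_product_at(1)[OF additive(4)] additive_op_product_at(2)[OF X]

private lemmas outer_zero = outer[THEN additive_op_zero]

private lemmas product_at_simps =
  product_at_partial_left[OF X] product_at_partial_left[OF additive(4)]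
  product_at_partial_right[OF X] product_at_partial_right[OF additive(4)]
  product_at_add_left[OF X] product_at_add_left[OF additive(4)]
  product_at_add_right[OF X] product_at_add_right[OF additive(4)]

private lemma eval_at_pCons_zero_outer:
  "eval_at X (\<lambda>r. product_at pr (\<lambda>P. X P + Z P) r c) (pCons 0 p)
     = X (eval_at X (\<lambda>r. product_at pr (\<lambda>P. X P + Z P) r c) p)"
  "eval_at Z (\<lambda>r. product_at pr X a r) (pCons 0 p) = Z (eval_at Z (\<lambda>r. product_at pr X a r) p)"
  by (rule eval_at_pCons_zero, rule additive, rule outer_zero)+

private lemma eval_at_partial_outer:
  "eval_at X (\<lambda>r. product_at pr (\<lambda>P. X P + Z P) r c) (map_poly (pCons 0) p)
     = eval_at X (\<lambda>r. product_at pr (\<lambda>P. X P + Z P) (pCons 0 r) c) p"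
  "eval_at Z (\<lambda>r. product_at pr X a r) (map_poly (pCons 0) p)
     = eval_at Z (\<lambda>r. product_at pr X a (pCons 0 r)) p"
  by (rule eval_at_map_poly, rule additive, rule outer_zero, simp)+

private lemmas eval_at_simps =
  eval_at_add[OF additive(1) outer(1)] eval_at_add[OF additive(2) outer(2)]
  eval_at_uminus[OF additive(1) outer(1)] eval_at_uminus[OF additive(2) outer(2)]
  eval_at_pCons_zero_outer eval_at_partial_outer

private lemmas eval_at_add_funs = eval_at_add_fun[OF additive(1)] eval_at_add_fun[OF additive(2)]

private lemmas diff_simps =
  additive_op_diff[OF additive(1)] additive_op_diff[OF additive(2)]
  additive_op_diff[OF additive_op_partial2]

lemma associator_add1:
  "conformal_associator pr X Z (a + a') b c =
     conformal_associator pr X Z a b c + conformal_associator pr X Z a' b c"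
  unfolding conformal_associator_def add_left product_at_simps eval_at_simps eval_at_add_funs
  by simp

lemma associator_add2:
  "conformal_associator pr X Z a (b + b') c =
     conformal_associator pr X Z a b c + conformal_associator pr X Z a b' c"
  unfolding conformal_associator_def add_left add_right eval_at_simps by simp

lemma associator_add3:
  "conformal_associator pr X Z a b (c + c') =
     conformal_associator pr X Z a b c + conformal_associator pr X Z a b c'"
  unfolding conformal_associator_def add_right product_at_simps eval_at_simps eval_at_add_funs
  by simp

lemma associator_partial1:
  "conformal_associator pr X Z (pCons 0 a) b c = - X (conformal_associator pr X Z a b c)"
proof -
  have "eval_at Z (\<lambda>r. - X (product_at pr X a r)) (pr b c)
      = - X (eval_at Z (\<lambda>r. product_at pr X a r) (pr b c))"
    by (rule eval_at_commute[where S = "\<lambda>P. - X P"])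
      (simp_all add: additive_op_def XZ additive_opD[OF additive(1)]
        additive_op_minus[OF additive(2)])
  then show ?thesis
    unfolding conformal_associator_def partial_left product_at_simps eval_at_simps diff_simps
    by (simp only: minus_diff_minus minus_diff_eq)
qed

text \<open>In \<open>(a\<^sub>X \<partial>b)\<^bsub>X+Z\<^esub> c\<close> the factor \<open>\<partial> + X\<close> produced by \<open>a\<^sub>X \<partial>b\<close> becomes \<open>-(X + Z) + X = -Z\<close>,
  because \<open>\<partial>\<close> then sits in the left argument of the outer product.\<close>

lemma associator_partial2:
  "conformal_associator pr X Z a (pCons 0 b) c = - Z (conformal_associator pr X Z a b c)"
proof -
  let ?f = "\<lambda>r. product_at pr (\<lambda>P. X P + Z P) r c"
  have "eval_at X (\<lambda>r. - (X (?f r) + Z (?f r))) (pr a b)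
     = - (X (eval_at X ?f (pr a b)) + Z (eval_at X ?f (pr a b)))"
    by (rule eval_at_commute[where S = "\<lambda>P. - (X P + Z P)"])
      (simp_all add: additive_op_def XZ additive_opD[OF additive(1)] additive_opD[OF additive(2)]
        additive_op_diff[OF additive(1)] additive_op_minus[OF additive(1)])
  then show ?thesis
    unfolding conformal_associator_def partial_left partial_right product_at_simps eval_at_simps
      diff_simps
    by simp
qed

lemma associator_partial3:
  "conformal_associator pr X Z a b (pCons 0 c) =
     partial2 (conformal_associator pr X Z a b c)
       + (X (conformal_associator pr X Z a b c) + Z (conformal_associator pr X Z a b c))"
proof -
  \<comment> \<open>Sesquilinearity on the right produces \<open>\<partial> + X + Z\<close> in \<open>(a\<^sub>X b)\<^bsub>X+Z\<^esub> \<partial>c\<close>, and \<open>\<partial> + X\<close>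
    next to \<open>Z\<close> in \<open>a\<^sub>X (b\<^sub>Z \<partial>c)\<close>.\<close>
  have 1: "eval_at X (\<lambda>r. partial2 (f r) + (X (f r) + Z (f r))) p
     = partial2 (eval_at X f p) + (X (eval_at X f p) + Z (eval_at X f p))"
    for f and p :: "'v poly poly"
    using X by (intro eval_at_commute[where S = "\<lambda>P. partial2 P + (X P + Z P)"])
     (simp_all add: additive_op_plus additive additive_op_partial2 additive_opD[OF additive(1)]
       XZ spectral_op_def)
  have 2: "eval_at Z (\<lambda>r. partial2 (f r) + X (f r)) p
     = partial2 (eval_at Z f p) + X (eval_at Z f p)"
    for f and p :: "'v poly poly"
    using Z by (intro eval_at_commute[where S = "\<lambda>P. partial2 P + X P"])
     (simp_all add: additive_op_plus additive additive_op_partial2 additive_opD[OF additive(2)]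
       XZ spectral_op_def)
  show ?thesis
    unfolding conformal_associator_def partial_right product_at_simps eval_at_simps 1 2
      diff_simps
    by simp
qed

end

text \<open>Since both sides are additive and transform in the same way under \<open>\<partial>\<close> in each argument, an
  induction on the polynomial in each argument in turn reduces the identity to generators.\<close>

lemma left_symmetric_extend:
  assumes "spectral_op X" "spectral_op Z" "\<And>P. X (Z P) = Z (X P)"
    and gen: "\<And>u v w. conformal_associator pr X Z [:u:] [:v:] [:w:]
      = conformal_associator pr Z X [:v:] [:u:] [:w:]"
  shows "conformal_associator pr X Z a b c = conformal_associator pr Z X b a c"
proof -
  have split: "pCons x p = [:x:] + pCons 0 p" for x :: 'v and p by simp
  have ZX_comm: "Z (X P) = X (Z P)" for P by (simp add: assms(3))
  note rules = associator_add1 associator_add2 associator_add3 associator_partial1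
    associator_partial2 associator_partial3
  note XZ = rules[OF assms(1,2), OF assms(3)] and ZX = rules[OF assms(2,1), OF ZX_comm]
  have zero: "conformal_associator pr X Z 0 b c = 0" "conformal_associator pr X Z a 0 c = 0"
    "conformal_associator pr X Z a b 0 = 0"
    "conformal_associator pr Z X 0 b c = 0" "conformal_associator pr Z X a 0 c = 0"
    "conformal_associator pr Z X a b 0 = 0" for a b c
    using XZ(1)[of 0 0 b c] XZ(2)[of a 0 0 c] XZ(3)[of a b 0 0]
      ZX(1)[of 0 0 b c] ZX(2)[of a 0 0 c] ZX(3)[of a b 0 0] by simp_all
  have 1: "conformal_associator pr X Z [:u:] [:v:] c = conformal_associator pr Z X [:v:] [:u:] c"
    for u v
  proof (induction c)
    case (pCons w c)
    then show ?case by (subst (1 2) split[of w c]) (simp only: XZ ZX gen add.commute)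
  qed (simp only: zero)
  have 2: "conformal_associator pr X Z [:u:] b c = conformal_associator pr Z X b [:u:] c" for u
  proof (induction b)
    case (pCons v b)
    then show ?case by (subst (1 2) split[of v b]) (simp only: XZ ZX 1)
  qed (simp only: zero)
  show ?thesis
  proof (induction a)
    case (pCons u a)
    then show ?case by (subst (1 2) split[of u a]) (simp only: XZ ZX 2)
  qed (simp only: zero)
qed

lemma conformal_left_symmetric_iff:
  "(eval_at mult_lam (\<lambda>r. product_at pr mult_lam_mu r c) (pr a b)
     - eval_at mult_mu (\<lambda>r. product_at pr mult_lam a r) (pr b c)
   = eval_at mult_mu (\<lambda>r. product_at pr mult_lam_mu r c) (pr b a)
     - eval_at mult_lam (\<lambda>r. product_at pr mult_mu b r) (pr a c))
   \<longleftrightarrow> conformal_associator pr mult_lam mult_mu a b c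
     = conformal_associator pr mult_mu mult_lam b a c"
  by (simp add: conformal_associator_def mult_lam_mu_def[abs_def] add.commute)

end


section \<open>The module \<open>\<complex>[\<partial>]V\<close>\<close>

lemma vector_space_map_poly:
  fixes s :: "complex \<Rightarrow> 'v::ab_group_add \<Rightarrow> 'v"
  assumes "vector_space s"
  shows "vector_space (\<lambda>k. map_poly (s k))"
proof -
  interpret vector_space s by fact
  show ?thesis
    by unfold_locales (simp_all add: poly_eq_iff coeff_map_poly scale_right_distrib
        scale_left_distrib)
qed

lemma free_smul_const: "free_smul s [:k:] = map_poly (s k)"
  by (simp add: fun_eq_iff free_smul_def eval_at_const)

lemma module_free_smul:
  fixes s :: "complex \<Rightarrow> 'v::ab_group_add \<Rightarrow> 'v"
  assumes "vector_space s"
  shows "module (free_smul s)"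
proof -
  interpret V: vector_space s by fact
  interpret P: vector_space "\<lambda>k. map_poly (s k)" using assms by (rule vector_space_map_poly)
  note X = additive_op_pCons_zero[where 'a = 'v]
  have pCons: "free_smul s (pCons k p) r = map_poly (s k) r + pCons 0 (free_smul s p r)" for k p r
    by (simp add: free_smul_def eval_at_pCons[OF X])
  have zero: "free_smul s 0 r = 0" for r by (simp add: free_smul_def eval_at_zero)
  have add_left: "free_smul s (p + q) r = free_smul s p r + free_smul s q r" for p q r
    by (simp add: free_smul_def eval_at_add[OF X] additive_op_def P.scale_left_distrib)
  have add_right: "free_smul s p (r + r') = free_smul s p r + free_smul s p r'" for p r r'
    by (simp add: free_smul_def P.scale_right_distrib eval_at_add_fun[OF X])
  have smult: "free_smul s (smult k q) r = map_poly (s k) (free_smul s q r)" for k q r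
    by (induction q) (simp_all add: zero pCons P.scale_right_distrib map_poly_pCons)
  have mult: "free_smul s (p * q) r = free_smul s p (free_smul s q r)" for p q r
    by (induction p) (simp_all add: zero pCons add_left smult)
  show ?thesis
    by unfold_locales (simp_all add: add_left add_right mult one_pCons free_smul_const)
qed

lemma bilinear_map_additive:
  assumes "bilinear_map s1 s2 s3 f"
  shows "additive_op (\<lambda>x. f x y)" "additive_op (f x)"
  using assms unfolding bilinear_map_def additive_op_def
  by (auto simp: Vector_Spaces.linear_iff)

lemma bilinear_map_scale:
  assumes "bilinear_map s1 s2 s3 f"
  shows "f (s1 k x) y = s3 k (f x y)" "f x (s2 k y) = s3 k (f x y)"
  using assms unfolding bilinear_map_def
  by (auto simp: Vector_Spaces.linear_iff)


section \<open>The product of three bilinear operations\<close>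

locale gd_operations =
  fixes scale :: "complex \<Rightarrow> 'v::ab_group_add \<Rightarrow> 'v"
    and lhd :: "'v \<Rightarrow> 'v \<Rightarrow> 'v" (infixl "\<lhd>" 70)
    and rhd :: "'v \<Rightarrow> 'v \<Rightarrow> 'v" (infixl "\<rhd>" 70)
    and circ :: "'v \<Rightarrow> 'v \<Rightarrow> 'v" (infixl "\<odot>" 70)
  assumes scale: "vector_space scale"
    and lhd: "bilinear_map scale scale scale lhd"
    and rhd: "bilinear_map scale scale scale rhd"
    and circ: "bilinear_map scale scale scale circ"
begin

abbreviation gen_product where
  "gen_product a b \<equiv> [:[:a \<odot> b, b \<lhd> a:], [:a \<rhd> b + b \<lhd> a:]:]"

lemmas additive_left = lhd[THEN bilinear_map_additive(1)] rhd[THEN bilinear_map_additive(1)]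
  circ[THEN bilinear_map_additive(1)]

lemmas additive_right = lhd[THEN bilinear_map_additive(2)] rhd[THEN bilinear_map_additive(2)]
  circ[THEN bilinear_map_additive(2)]

lemmas distribs =
  additive_left[THEN additive_opD] additive_right[THEN additive_opD]
  additive_left[THEN additive_op_diff] additive_right[THEN additive_op_diff]
  additive_left[THEN additive_op_minus] additive_right[THEN additive_op_minus]
  additive_left[THEN additive_op_zero] additive_right[THEN additive_op_zero]

lemma gen_product_add:
  "gen_product (u + u') v = gen_product u v + gen_product u' v"
  "gen_product u (v + v') = gen_product u v + gen_product u v'"
  by (simp_all add: distribs algebra_simps)

abbreviation gd where "gd \<equiv> gd_product lhd rhd circ"

lemma gd_gen: "gd [:u:] [:v:] = gen_product u v"
  by (simp only: gd_product_def conformal_extension_gen[of gen_product, OF gen_product_add])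

sublocale sesquilinear_product gd
  unfolding gd_product_def
  using conformal_extension_add_left[of gen_product, OF gen_product_add]
    conformal_extension_add_right[of gen_product, OF gen_product_add]
    conformal_extension_partial_left[of gen_product, OF gen_product_add]
    conformal_extension_partial_right[of gen_product, OF gen_product_add]
  by unfold_locales

text \<open>A complex scalar commutes with the operators \<open>-\<lambda>\<close> and \<open>\<partial> + \<lambda>\<close> at which the conformal
  extension evaluates, so homogeneity passes from \<open>V\<close> to \<open>\<complex>[\<partial>]V\<close>.\<close>

lemma gd_scale:
  "gd (map_poly (scale k) a) b = map_poly (map_poly (scale k)) (gd a b)"
  "gd a (map_poly (scale k) b) = map_poly (map_poly (scale k)) (gd a b)"
proof -
  interpret V: vector_space scale by (rule scale)
  let ?S = "map_poly (map_poly (scale k)) :: 'v poly poly \<Rightarrow> 'v poly poly"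
  have S: "additive_op ?S"
    by (intro additive_op_map_poly) (simp add: additive_op_def V.scale_right_distrib)
  have S1: "?S (- pCons 0 P) = - pCons 0 (?S P)"
    "?S (map_poly (pCons 0) P + pCons 0 P) = map_poly (pCons 0) (?S P) + pCons 0 (?S P)" for P
    by (simp_all add: additive_op_minus[OF S] additive_opD[OF S])
      (simp_all add: poly_eq_iff coeff_map_poly coeff_pCons split: nat.splits)
  have gen: "gen_product (scale k u) v = ?S (gen_product u v)"
     "gen_product u (scale k v) = ?S (gen_product u v)" for u v
    by (simp_all add: map_poly_pCons V.scale_right_distrib bilinear_map_scale[OF lhd]
        bilinear_map_scale[OF rhd] bilinear_map_scale[OF circ])
  have zero: "gen_product u 0 = 0" "gen_product 0 v = 0" for u v by (simp_all add: distribs)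
  let ?R = "\<lambda>P :: 'v poly poly. map_poly (pCons 0) P + pCons 0 P"
  have inner: "eval_at ?R (\<lambda>v. ?S (gen_product u v)) b = ?S (eval_at ?R (gen_product u) b)" for u b
    by (rule eval_at_commute[where S = ?S and X = ?R]) (simp_all only: S S1)
  have outer: "eval_at (\<lambda>P. - pCons 0 P) (\<lambda>u. ?S (eval_at ?R (gen_product u) b)) a
    = ?S (gd a b)" for a b
    unfolding gd_product_def conformal_extension_def
    by (rule eval_at_commute[where S = ?S and X = "\<lambda>P. - pCons 0 P"]) (simp_all only: S S1)
  have zero': "eval_at ?R (gen_product 0) b = 0" for b
    using conformal_extension_zero(1,3)[of gen_product, OF gen_product_add] by simp
  show "gd (map_poly (scale k) a) b = ?S (gd a b)"
    unfolding outer[symmetric] inner[symmetric] gen(1)[symmetric]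
    unfolding gd_product_def conformal_extension_def
    by (rule eval_at_map_poly[where s = "scale k"
          and f = "\<lambda>u. eval_at ?R (gen_product u) b" and X = "\<lambda>P. - pCons 0 P"])
      (rule additive_op_left zero' V.scale_zero_right)+
  have "eval_at ?R (gen_product u) (map_poly (scale k) b)
      = eval_at ?R (\<lambda>v. gen_product u (scale k v)) b" for u
    by (rule eval_at_map_poly[where s = "scale k" and f = "gen_product u" and X = ?R])
      (rule additive_op_right zero V.scale_zero_right)+
  then show "gd a (map_poly (scale k) b) = ?S (gd a b)"
    unfolding outer[symmetric] inner[symmetric] gen(2)[symmetric]
    by (simp only: gd_product_def conformal_extension_def)
qed

lemma gd_bilinear:
  "bilinear_map (\<lambda>k. free_smul scale [:k:]) (\<lambda>k. free_smul scale [:k:])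
     (\<lambda>k. map_poly (free_smul scale [:k:])) gd"
  using vector_space_map_poly[OF scale] vector_space_map_poly[OF vector_space_map_poly[OF scale]]
  by (simp add: bilinear_map_def free_smul_const Vector_Spaces.linear_iff add_left add_right
      gd_scale)

lemma left_symmetric_conformal_algebra_iff:
  "left_symmetric_conformal_algebra (free_smul scale) gd \<longleftrightarrow>
     (\<forall>a b c. conformal_associator gd mult_lam mult_mu [:a:] [:b:] [:c:]
        = conformal_associator gd mult_mu mult_lam [:b:] [:a:] [:c:])"
  (is "?L \<longleftrightarrow> ?R")
proof
  assume ?L
  then interpret left_symmetric_conformal_algebra "free_smul scale" gd .
  show ?R using conformal_left_symmetric unfolding conformal_left_symmetric_iff by blast
next
  assume ?R
  then show ?L
    unfolding left_symmetric_conformal_algebra_def left_symmetric_conformal_algebra_axioms_def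
      conformal_left_symmetric_iff free_smul_partial[OF scale]
    using left_symmetric_extend[OF spectral_op_mult_lam spectral_op_mult_mu mult_lam_mult_mu]
    by (auto simp: module_free_smul[OF scale] gd_bilinear partial_left partial_right)
qed


section \<open>The identity on generators\<close>

lemma product_at_gen:
  assumes "spectral_op X"
  shows "product_at gd X [:a:] [:b:] = [:[:[:a \<odot> b, b \<lhd> a:]:]:] + X [:[:[:a \<rhd> b + b \<lhd> a:]:]:]"
proof -
  have X: "additive_op X" using assms by (simp add: spectral_op_def)
  show ?thesis
    unfolding product_at_def gd_gen
    by (simp add: eval_at_pCons[OF X] eval_at_zero additive_op_zero[OF X])
qed

lemma product_at_linear:
  assumes "spectral_op X"
  shows "product_at gd X [:x, y:] c = product_at gd X [:x:] c - X (product_at gd X [:y:] c)"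
    "product_at gd X a [:x, y:] = product_at gd X a [:x:]
       + (partial2 (product_at gd X a [:y:]) + X (product_at gd X a [:y:]))"
  using product_at_add_left[OF assms, of "[:x:]" "pCons 0 [:y:]" c]
    product_at_add_right[OF assms, of a "[:x:]" "pCons 0 [:y:]"]
  unfolding product_at_partial_left[OF assms] product_at_partial_right[OF assms]
  by simp_all

lemma associator_gen:
  assumes X: "spectral_op X" and Z: "spectral_op Z"
  shows "conformal_associator gd X Z [:a:] [:b:] [:c:] =
    product_at gd (\<lambda>P. X P + Z P) [:a \<odot> b, b \<lhd> a:] [:c:]
      + X (product_at gd (\<lambda>P. X P + Z P) [:a \<rhd> b + b \<lhd> a:] [:c:])
      - (product_at gd X [:a:] [:b \<odot> c, c \<lhd> b:]
        + Z (product_at gd X [:a:] [:b \<rhd> c + c \<lhd> b:]))"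
proof -
  have z: "product_at gd (\<lambda>P. X P + Z P) 0 c = 0" "product_at gd X a 0 = 0" for a c
    using additive_op_zero[OF additive_op_product_at(1)[OF spectral_op_plus[OF X Z]]]
      additive_op_zero[OF additive_op_product_at(2)[OF X]] by auto
  have X': "additive_op X" and Z': "additive_op Z"
    using X Z by (simp_all add: spectral_op_def)
  show ?thesis
    by (simp add: conformal_associator_def gd_gen eval_at_pCons[OF X'] eval_at_pCons[OF Z']
        eval_at_zero z additive_op_zero[OF X'] additive_op_zero[OF Z'])
qed

text \<open>The coefficients of the conformal associator of \<open>a\<close>, \<open>b\<close>, \<open>c \<in> V\<close> at \<open>1\<close>, \<open>X\<close>, \<open>X\<^sup>2\<close>, \<open>Z\<close>, \<open>XZ\<close>,
  \<open>Z\<^sup>2\<close>, each a polynomial in \<open>\<partial>\<close>.  They come from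
  \<open>(a\<^sub>X b)\<^bsub>X+Z\<^esub> c = (X (a \<rhd> b) - Z (b \<lhd> a) + a \<circ> b)\<^bsub>X+Z\<^esub> c\<close> and from
  \<open>a\<^sub>X (b\<^sub>Z c) = (\<partial> + X) (a\<^sub>X (c \<lhd> b)) + a\<^sub>X (b \<circ> c) + Z (a\<^sub>X (b \<rhd> c + c \<lhd> b))\<close>.\<close>


definition coeff_1 where "coeff_1 a b c = [: (a \<odot> b) \<odot> c - a \<odot> (b \<odot> c),
   c \<lhd> (a \<odot> b) - a \<odot> (c \<lhd> b) - (b \<odot> c) \<lhd> a, - ((c \<lhd> b) \<lhd> a) :]"
definition coeff_X where "coeff_X a b c =
  [: (a \<rhd> b) \<odot> c + (a \<odot> b) \<rhd> c + c \<lhd> (a \<odot> b) - a \<odot> (c \<lhd> b) - a \<rhd> (b \<odot> c) - (b \<odot> c) \<lhd> a,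
     c \<lhd> (a \<rhd> b) - a \<rhd> (c \<lhd> b) - (c \<lhd> b) \<lhd> a - (c \<lhd> b) \<lhd> a :]"
definition coeff_XX where "coeff_XX a b c =
  [: (a \<rhd> b) \<rhd> c + c \<lhd> (a \<rhd> b) - a \<rhd> (c \<lhd> b) - (c \<lhd> b) \<lhd> a :]"
definition coeff_Z where "coeff_Z a b c =
  [: (a \<odot> b) \<rhd> c + c \<lhd> (a \<odot> b) - (b \<lhd> a) \<odot> c - a \<odot> (b \<rhd> c + c \<lhd> b),
     - (c \<lhd> (b \<lhd> a)) - (b \<rhd> c + c \<lhd> b) \<lhd> a :]"
definition coeff_XZ where "coeff_XZ a b c =
  [: (a \<rhd> b) \<rhd> c + c \<lhd> (a \<rhd> b) - (b \<lhd> a) \<rhd> c - c \<lhd> (b \<lhd> a)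
      - a \<rhd> (b \<rhd> c + c \<lhd> b) - (b \<rhd> c + c \<lhd> b) \<lhd> a :]"
definition coeff_ZZ where "coeff_ZZ a b c = [: - ((b \<lhd> a) \<rhd> c) - c \<lhd> (b \<lhd> a) :]"

lemmas coeff_defs = coeff_1_def coeff_X_def coeff_XX_def coeff_Z_def coeff_XZ_def coeff_ZZ_def

lemma associator_lam_mu:
  "conformal_associator gd mult_lam mult_mu [:a:] [:b:] [:c:] =
     [:[:coeff_1 a b c, coeff_X a b c, coeff_XX a b c:], [:coeff_Z a b c, coeff_XZ a b c:],
       [:coeff_ZZ a b c:]:]"
  unfolding associator_gen[OF spectral_op_mult_lam spectral_op_mult_mu]
    product_at_linear[OF spectral_op_mult_lam]
    product_at_linear[OF spectral_op_plus[OF spectral_op_mult_lam spectral_op_mult_mu]]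
    product_at_gen[OF spectral_op_mult_lam]
    product_at_gen[OF spectral_op_plus[OF spectral_op_mult_lam spectral_op_mult_mu]]
  by (simp add: mult_lam_def mult_mu_def map_poly_pCons coeff_defs distribs)

text \<open>Exchanging \<open>\<lambda>\<close> and \<open>\<mu>\<close> transposes the array of coefficients.\<close>

lemma associator_mu_lam:
  "conformal_associator gd mult_mu mult_lam [:a:] [:b:] [:c:] =
     [:[:coeff_1 a b c, coeff_Z a b c, coeff_ZZ a b c:], [:coeff_X a b c, coeff_XZ a b c:],
       [:coeff_XX a b c:]:]"
  unfolding associator_gen[OF spectral_op_mult_mu spectral_op_mult_lam]
    product_at_linear[OF spectral_op_mult_mu]
    product_at_linear[OF spectral_op_plus[OF spectral_op_mult_mu spectral_op_mult_lam]]
    product_at_gen[OF spectral_op_mult_mu]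
    product_at_gen[OF spectral_op_plus[OF spectral_op_mult_mu spectral_op_mult_lam]]
  by (simp add: mult_lam_def mult_mu_def map_poly_pCons coeff_defs distribs)

text \<open>For each defining identity of a pre-Gel'fand-Dorfman algebra, its left-hand side minus its
  right-hand side.  As elements of \<open>V\<close> these can be added and compared with the coefficients
  above.\<close>

definition "left_symmetric_defect a b c =
  (a \<odot> b) \<odot> c - a \<odot> (b \<odot> c) - ((b \<odot> a) \<odot> c - b \<odot> (a \<odot> c))"
definition "pn1_defect a b c =
  a \<rhd> (b \<rhd> c) - ((a \<rhd> b + a \<lhd> b) \<rhd> c + b \<rhd> (a \<rhd> c) - (b \<rhd> a + b \<lhd> a) \<rhd> c)"
definition "pn2_defect a b c =
  a \<rhd> (b \<lhd> c) - ((a \<rhd> b) \<lhd> c + b \<lhd> (a \<lhd> c + a \<rhd> c) - (b \<lhd> a) \<lhd> c)"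
definition "pn3_defect a b c = (a \<lhd> b + a \<rhd> b) \<rhd> c - (a \<rhd> c) \<lhd> b"
definition "pn4_defect a b c = (a \<lhd> b) \<lhd> c - (a \<lhd> c) \<lhd> b"
definition "gd1_defect a b c =
  c \<lhd> (a \<odot> b - b \<odot> a) - a \<odot> (c \<lhd> b) - (b \<odot> c) \<lhd> a - (- (b \<odot> (c \<lhd> a)) - (a \<odot> c) \<lhd> b)"
definition "gd2_defect a b c =
  (a \<odot> b - b \<odot> a) \<rhd> c + (a \<lhd> b + a \<rhd> b) \<odot> c
    - (a \<rhd> (b \<odot> c) - b \<odot> (a \<rhd> c) + (a \<odot> c) \<lhd> b)"

lemmas defect_defs = left_symmetric_defect_def pn1_defect_def pn2_defect_def pn3_defect_def
  pn4_defect_def gd1_defect_def gd2_defect_def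

abbreviation no_defects where
  "no_defects \<equiv>
    (\<forall>a b c. left_symmetric_defect a b c = 0 \<and> pn1_defect a b c = 0 \<and> pn2_defect a b c = 0 \<and>
      pn3_defect a b c = 0 \<and> pn4_defect a b c = 0 \<and> gd1_defect a b c = 0 \<and> gd2_defect a b c = 0)"

lemma pre_gelfand_dorfman_algebra_iff_defects:
  "pre_gelfand_dorfman_algebra scale lhd rhd circ \<longleftrightarrow> no_defects"
  (is "?L \<longleftrightarrow> ?R")
proof
  assume ?L
  then interpret pre_gelfand_dorfman_algebra scale lhd rhd circ .
  show ?R
    unfolding defect_defs right_minus_eq
    by (intro allI conjI left_symmetric pre_novikov1 pre_novikov2 pre_novikov3 pre_novikov4
        pre_gd1 pre_gd2)
next
  assume ?R
  then have "left_symmetric_defect a b c = 0" "pn1_defect a b c = 0" "pn2_defect a b c = 0"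
    "pn3_defect a b c = 0" "pn4_defect a b c = 0" "gd1_defect a b c = 0" "gd2_defect a b c = 0"
    for a b c by simp_all
  note axioms = this[unfolded defect_defs right_minus_eq]
  show ?L
    by (intro pre_gelfand_dorfman_algebra.intro pre_gelfand_dorfman_algebra_axioms.intro
        pre_novikov_algebra.intro pre_novikov_algebra_axioms.intro
        left_symmetric_algebra.intro left_symmetric_algebra_axioms.intro)
      (rule scale lhd rhd circ axioms)+
qed

text \<open>The conditions imposed by conformal left-symmetry, in terms of the axioms of a
  pre-Gel'fand-Dorfman algebra.  Read from top to bottom and left to right, each entry contains, up
  to sign, one defect of a new kind besides defects of kinds that occur earlier in the list.\<close>

lemma coeff_differences:
  "coeff_1 a b c - coeff_1 b a c
     = [:left_symmetric_defect a b c, gd1_defect a b c, - pn4_defect c b a:]"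
  "coeff_X a b c - coeff_Z b a c
     = [:gd2_defect a b c + gd1_defect a b c,
         - pn2_defect a c b - pn4_defect c b a - pn4_defect c b a:]"
  "coeff_XX a b c - coeff_ZZ b a c = [:pn3_defect a b c - pn2_defect a c b - pn4_defect c b a:]"
  "coeff_XZ a b c - coeff_XZ b a c
     = [:- pn1_defect a b c - pn2_defect a c b + pn2_defect b c a
         - pn4_defect c b a - pn4_defect c b a:]"
  by (simp_all add: coeff_defs defect_defs distribs algebra_simps)

lemma associator_symmetric_iff_defects:
  "(\<forall>a b c. conformal_associator gd mult_lam mult_mu [:a:] [:b:] [:c:]
      = conformal_associator gd mult_mu mult_lam [:b:] [:a:] [:c:]) \<longleftrightarrow> no_defects"
  (is "?L \<longleftrightarrow> ?R")
proof -
  \<comment> \<open>The conditions from \<open>\<mu>\<close> and \<open>\<mu>\<^sup>2\<close> are those from \<open>\<lambda>\<close> and \<open>\<lambda>\<^sup>2\<close> with \<open>a\<close> and \<open>b\<close> exchanged.\<close>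
  have "?L \<longleftrightarrow> (\<forall>a b c. coeff_1 a b c - coeff_1 b a c = 0 \<and> coeff_X a b c - coeff_Z b a c = 0 \<and>
      coeff_XX a b c - coeff_ZZ b a c = 0 \<and> coeff_XZ a b c - coeff_XZ b a c = 0)"
    unfolding associator_lam_mu associator_mu_lam pCons_eq_iff right_minus_eq by metis
  also have "\<dots> \<longleftrightarrow> ?R"
  proof (intro iffI allI)
    fix a b c
    assume *: "\<forall>a b c. coeff_1 a b c - coeff_1 b a c = 0 \<and> coeff_X a b c - coeff_Z b a c = 0 \<and>
      coeff_XX a b c - coeff_ZZ b a c = 0 \<and> coeff_XZ a b c - coeff_XZ b a c = 0"
    have 1: "left_symmetric_defect a b c = 0" "gd1_defect a b c = 0" "pn4_defect a b c = 0"
      for a b c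
      using * unfolding coeff_differences by simp_all
    have 2: "pn2_defect a b c = 0" "gd2_defect a b c = 0" for a b c
      using * unfolding coeff_differences by (simp_all add: 1)
    have "pn1_defect a b c = 0" "pn3_defect a b c = 0"
      using * unfolding coeff_differences by (simp_all add: 1 2)
    then show "left_symmetric_defect a b c = 0 \<and> pn1_defect a b c = 0 \<and> pn2_defect a b c = 0 \<and>
      pn3_defect a b c = 0 \<and> pn4_defect a b c = 0 \<and> gd1_defect a b c = 0 \<and> gd2_defect a b c = 0"
      by (simp add: 1 2)
  qed (simp add: coeff_differences)
  finally show ?thesis .
qed

text \<open>The product of two generators has the quadratic form by its definition.\<close>

lemma quadratic_iff:
  "quadratic_left_symmetric_conformal_algebra scale gd \<longleftrightarrow>
     left_symmetric_conformal_algebra (free_smul scale) gd"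
  unfolding quadratic_left_symmetric_conformal_algebra_def
    quadratic_left_symmetric_conformal_algebra_axioms_def gd_gen
  using scale by auto

end

theorem theorem2p21:
  fixes scale :: "complex \<Rightarrow> 'v::ab_group_add \<Rightarrow> 'v"
    and lhd rhd circ :: "'v \<Rightarrow> 'v \<Rightarrow> 'v"
  assumes "vector_space scale"
    and "bilinear_map scale scale scale lhd"
    and "bilinear_map scale scale scale rhd"
    and "bilinear_map scale scale scale circ"
  shows "(left_symmetric_conformal_algebra (free_smul scale) (gd_product lhd rhd circ)
            \<longleftrightarrow> pre_gelfand_dorfman_algebra scale lhd rhd circ) \<and>
         (quadratic_left_symmetric_conformal_algebra scale (gd_product lhd rhd circ)
            \<longleftrightarrow> pre_gelfand_dorfman_algebra scale lhd rhd circ)"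
proof -
  interpret gd_operations scale lhd rhd circ
    using assms by (simp add: gd_operations_def)
  show ?thesis
    unfolding quadratic_iff left_symmetric_conformal_algebra_iff associator_symmetric_iff_defects
      pre_gelfand_dorfman_algebra_iff_defects by simp
qed

end
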